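(* Let $\mathcal X\subset\mathbb R^m$ be compact, $A\in\mathbb R^{d\times m}$, $b\in\mathbb R^d$, $\alpha>0$, $\beta>0$, and let $g:\mathbb R^d\to\mathbb R$ be convex and differentiable with globally $\frac1\beta$-Lipschitz gradient. Let $\rho,\eta\in\mathcal P(\mathcal X)$ and let $z_\rho,z_\eta$ be the solutions of the dual MEM problem with prior $\rho$ and $\eta$, respectively. Then: (i) Letting $G=\partial\phi_\eta(z_\rho)\cup\partial\phi_\rho(z_\eta)$, $$\|z_\rho-z_\eta\|\le\frac\alpha\beta\min_{v\in G}\|v\|.$$ (ii) For any $z\in\mathbb R^d$, $$\|z_\eta-z\|\le\frac\alpha\beta\Big[\min_{v_g\in\partial g^*(-z/\alpha)}\|v_g\|+\|b\|+\|A\|\,|\mathrm{supp}(\eta)|_\infty\Big],$$ whereby $$\|z_\eta\|\le\frac\alpha\beta\Big[\min_{v_g\in\partial g^*(-z/\alpha)}\|v_g\|+\|b\|+\|A\|\,|\mathrm{supp}(\eta)|_\infty\Big]+\|z\|.$$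
   Context: $\mathcal P(\mathcal X)$ is the set of Borel probability measures on $\mathcal X$. $\|\cdot\|$ is the Euclidean norm on vectors and the operator $2$-norm on matrices; for a set $S$, $|S|_\infty:=\sup_{s\in S}\|s\|$. $g^*$ is the Fenchel conjugate of $g$ and $\partial$ denotes the convex subdifferential. For $\mu\in\mathcal P(\mathcal X)$, $L_\mu(y):=\log\int_{\mathcal X}\exp\langle y,u\rangle\,d\mu(u)$, and the dual MEM problem with prior $\mu$ is to minimize over $z\in\mathbb R^d$ the function $\phi_\mu(z):=\alpha g^*(-z/\alpha)-\langle b,z\rangle+L_\mu(A^\top z)$, which is $\frac\beta\alpha$-strongly convex and has a unique minimizer $z_\mu$. Convention: a minimum over the empty set equals $+\infty$ (so (ii) is vacuous when $\partial g^*(-z/\alpha)=\emptyset$). *)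

theory Defs
  imports "HOL-Analysis.Analysis" "HOL-Probability.Probability_Measure"
begin

text \<open>Convex-analysis notions are extended-real valued, since the conjugate of a finite
  function may take the value \<open>\<infinity>\<close>.\<close>

definition fenchel_conjugate :: "('a::real_inner \<Rightarrow> real) \<Rightarrow> 'a \<Rightarrow> ereal" where
  "fenchel_conjugate g y = (SUP x. ereal (y \<bullet> x - g x))"

text \<open>As usual, the subdifferential is empty outside the effective domain.\<close>

definition subdifferential :: "('a::real_inner \<Rightarrow> ereal) \<Rightarrow> 'a \<Rightarrow> 'a set" where
  "subdifferential f x = {v. \<bar>f x\<bar> \<noteq> \<infinity> \<and> (\<forall>y. f x + ereal (v \<bullet> (y - x)) \<le> f y)}"

text \<open>Minimum (not infimum) of the norm over a set; inserting \<open>\<infinity>\<close> encodes the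
  convention that the minimum over the empty set is \<open>\<infinity>\<close> and changes nothing otherwise.\<close>

definition min_norm :: "'a::real_normed_vector set \<Rightarrow> ereal" where
  "min_norm S = (LEAST r. r \<in> insert \<infinity> ((\<lambda>v. ereal (norm v)) ` S))"

definition sup_norm :: "'a::real_normed_vector set \<Rightarrow> ereal" where
  "sup_norm S = (SUP s\<in>S. ereal (norm s))"

text \<open>Borel probability measures on the subspace \<open>X\<close>; such a measure has \<open>space \<mu> = X\<close>.\<close>

definition borel_probs :: "'a::topological_space set \<Rightarrow> 'a measure set" where
  "borel_probs X = {\<mu>. prob_space \<mu> \<and> sets \<mu> = sets (restrict_space borel X)}"

text \<open>The relatively open subsets of \<open>space \<mu>\<close> are the sets \<open>U \<inter> space \<mu>\<close> with \<open>U\<close> open.\<close>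

definition measure_supp :: "'a::topological_space measure \<Rightarrow> 'a set" where
  "measure_supp \<mu> =
     {x \<in> space \<mu>. \<forall>U. open U \<longrightarrow> x \<in> U \<longrightarrow> emeasure \<mu> (U \<inter> space \<mu>) > 0}"

definition log_mgf :: "'a::euclidean_space measure \<Rightarrow> 'a \<Rightarrow> real" where
  "log_mgf \<mu> y = ln (\<integral>u. exp (y \<bullet> u) \<partial>\<mu>)"

definition dual_mem ::
  "(real^'d \<Rightarrow> real) \<Rightarrow> real^'m^'d \<Rightarrow> real^'d \<Rightarrow> real \<Rightarrow> (real^'m) measure \<Rightarrow> real^'d \<Rightarrow> ereal"
  where
  "dual_mem g A b \<alpha> \<mu> z =
     ereal \<alpha> * fenchel_conjugate g (- z /\<^sub>R \<alpha>) - ereal (b \<bullet> z)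
       + ereal (log_mgf \<mu> (transpose A *v z))"

definition dual_mem_solution ::
  "(real^'d \<Rightarrow> real) \<Rightarrow> real^'m^'d \<Rightarrow> real^'d \<Rightarrow> real \<Rightarrow> (real^'m) measure \<Rightarrow> real^'d \<Rightarrow> bool"
  where
  "dual_mem_solution g A b \<alpha> \<mu> z \<longleftrightarrow> is_arg_min (dual_mem g A b \<alpha> \<mu>) (\<lambda>_. True) z"

end

theory Submission
  imports Defs
begin

text \<open>
  Both bounds measure how far the minimizer of a strongly convex function is from another point
  at which the function has a small subgradient. If \<open>f\<close> is \<open>c\<close>-strongly convex, its subdifferential
  is strongly monotone, so comparing a subgradient \<open>v\<close> at \<open>y\<close> with the subgradient \<open>0\<close> at the
  minimizer \<open>x\<close> gives \<open>c * (norm (y - x))\<^sup>2 \<le> v \<bullet> (y - x)\<close> and hence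
  \<open>norm (x - y) \<le> norm v / c\<close> (lemma \<open>minimizer_distance_le\<close>). For the dual objective
  \<open>c = \<beta> / \<alpha>\<close>; bound (i) is this estimate for each of the two objectives, at the minimizer of the
  other one.

  Strong convexity of the dual objective comes from its conjugate term. The gradient of \<open>g\<close> being
  \<open>1 / \<beta>\<close>-Lipschitz, \<open>g\<close> lies below a paraboloid of curvature \<open>1 / \<beta>\<close> touching it at any chosen
  point; testing the suprema that define the conjugate at two suitably shifted points turns
  this into \<open>\<beta>\<close>-strong convexity of the conjugate (\<open>strongly_convex_fenchel_conjugate\<close>). Adding
  the log-moment generating function preserves the modulus because that function is convex.

  For bound (ii) an explicit subgradient of the dual objective at \<open>z\<close> is assembled from a
  subgradient of the conjugate at \<open>- z / \<alpha>\<close>, the vector \<open>b\<close>, and \<open>A\<close> applied to a subgradient of the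
  log-moment generating function. The latter is the mean of the exponentially tilted measure
  (\<open>log_mgf_subgradient\<close>); being an average over the support, it is no longer than the supremum of
  the norms there. Since a subgradient exists at every point, the same lemma also yields
  the convexity needed above.

  The minima of norms in the statement are attained because subdifferentials are closed; this
  reduces both bounds to estimates for a single subgradient.
\<close>

section \<open>Subdifferentials and attained minimal norms\<close>

text \<open>Each test point \<open>y\<close> contributes a closed half-space, the whole space or the empty set, so the
  subdifferential is an intersection of closed sets.\<close>

lemma closed_subdifferential: "closed (subdifferential f x)"
proof (cases "\<bar>f x\<bar> = \<infinity>")
  case True
  then show ?thesis by (simp add: subdifferential_def)
next
  case False
  then obtain r where r: "f x = ereal r" by auto
  have "closed {v. f x + ereal (v \<bullet> (y - x)) \<le> f y}" for y
  proof (cases "f y")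
    case (real s)
    have "closed {v. r + v \<bullet> (y - x) \<le> s}"
      by (intro closed_Collect_le continuous_intros)
    then show ?thesis by (simp add: r real)
  qed (simp_all add: r)
  then have "closed (\<Inter>y. {v. f x + ereal (v \<bullet> (y - x)) \<le> f y})"
    by blast
  also have "(\<Inter>y. {v. f x + ereal (v \<bullet> (y - x)) \<le> f y}) = subdifferential f x"
    using False by (auto simp: subdifferential_def)
  finally show ?thesis .
qed

text \<open>Closedness makes the least element in the definition of \<open>min_norm\<close> exist; otherwise that
  definition would denote an unspecified value.\<close>

lemma min_norm_cases:
  fixes S :: "'a::euclidean_space set"
  assumes "closed S"
  obtains "min_norm S = \<infinity>" | v where "v \<in> S" "min_norm S = ereal (norm v)"
proof (cases "S = {}")
  case True
  then have "min_norm S = \<infinity>"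
    by (auto simp: min_norm_def intro!: Least_equality)
  then show ?thesis by (rule that)
next
  case False
  obtain v where v: "v \<in> S" "\<And>w. w \<in> S \<Longrightarrow> norm v \<le> norm w"
    using distance_attains_inf[OF assms False, of 0] by auto
  then have "min_norm S = ereal (norm v)"
    unfolding min_norm_def by (intro Least_equality) auto
  with v show ?thesis using that by blast
qed

lemma minimizer_zero_subgradient:
  assumes "is_arg_min f (\<lambda>_. True) x" "\<bar>f x\<bar> \<noteq> \<infinity>"
  shows "0 \<in> subdifferential f x"
  using assms by (auto simp: is_arg_min_linorder subdifferential_def)

section \<open>Strong convexity\<close>

text \<open>The inequality is required only between points of finite value, where both sides can be written
  with real numbers; this avoids sums of opposite infinities.\<close>

definition strongly_convex :: "real \<Rightarrow> ('a::real_inner \<Rightarrow> ereal) \<Rightarrow> bool" where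
  "strongly_convex c f \<longleftrightarrow> (\<forall>x y p q t. f x = ereal p \<longrightarrow> f y = ereal q \<longrightarrow> 0 < t \<longrightarrow> t < 1 \<longrightarrow>
     f ((1 - t) *\<^sub>R x + t *\<^sub>R y)
       \<le> ereal ((1 - t) * p + t * q - c / 2 * (t * (1 - t)) * (norm (x - y))\<^sup>2))"

lemma strongly_convexD:
  assumes "strongly_convex c f" "f x = ereal p" "f y = ereal q" "0 < t" "t < 1"
  shows "f ((1 - t) *\<^sub>R x + t *\<^sub>R y)
       \<le> ereal ((1 - t) * p + t * q - c / 2 * (t * (1 - t)) * (norm (x - y))\<^sup>2)"
  using assms unfolding strongly_convex_def by blast

text \<open>The two subgradient inequalities are evaluated at points of the segment at relative distance
  \<open>t\<close> from \<open>x\<close> and from \<open>y\<close>, and compared with strong convexity there. Adding them and dividing by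
  \<open>t\<close> gives the claim up to the factor \<open>1 - t\<close>, which disappears as \<open>t\<close> tends to \<open>0\<close>. (The midpoint
  alone would lose a factor of two.)\<close>

lemma subdifferential_strongly_monotone:
  assumes sc: "strongly_convex c f"
    and v: "v \<in> subdifferential f x" and w: "w \<in> subdifferential f y"
  shows "c * (norm (x - y))\<^sup>2 \<le> (v - w) \<bullet> (x - y)"
proof (rule field_le_mult_one_interval)
  \<comment> \<open>It suffices to prove the inequality with the left-hand side scaled by any \<open>s = 1 - t < 1\<close>,
    which replaces the limit \<open>t \<rightarrow> 0\<close>.\<close>
  fix s :: real
  assume s: "0 < s" "s < 1"
  define t where "t = 1 - s"
  have t: "0 < t" "t < 1" using s by (auto simp: t_def)
  obtain p where p: "f x = ereal p" using v by (auto simp: subdifferential_def)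
  obtain q where q: "f y = ereal q" using w by (auto simp: subdifferential_def)
  have "ereal p + ereal (v \<bullet> ((1 - t) *\<^sub>R x + t *\<^sub>R y - x)) \<le> f ((1 - t) *\<^sub>R x + t *\<^sub>R y)"
    using v p by (auto simp: subdifferential_def)
  from order_trans[OF this strongly_convexD[OF sc p q t]]
  have 1: "p + v \<bullet> ((1 - t) *\<^sub>R x + t *\<^sub>R y - x)
      \<le> (1 - t) * p + t * q - c / 2 * (t * (1 - t)) * (norm (x - y))\<^sup>2" by simp
  have "ereal q + ereal (w \<bullet> ((1 - t) *\<^sub>R y + t *\<^sub>R x - y)) \<le> f ((1 - t) *\<^sub>R y + t *\<^sub>R x)"
    using w q by (auto simp: subdifferential_def)
  from order_trans[OF this strongly_convexD[OF sc q p t]]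
  have 2: "q + w \<bullet> ((1 - t) *\<^sub>R y + t *\<^sub>R x - y)
      \<le> (1 - t) * q + t * p - c / 2 * (t * (1 - t)) * (norm (x - y))\<^sup>2"
    by (simp add: norm_minus_commute)
  define d where "d = x - y"
  have e1: "(1 - t) *\<^sub>R x + t *\<^sub>R y - x = - (t *\<^sub>R d)"
    and e2: "(1 - t) *\<^sub>R y + t *\<^sub>R x - y = t *\<^sub>R d"
    by (simp_all add: d_def algebra_simps)
  define k where "k = c / 2 * (t * (1 - t)) * (norm d)\<^sup>2"
  have "2 * k \<le> t * ((v - w) \<bullet> d)"
    using 1 2 unfolding e1 e2 d_def[symmetric] k_def[symmetric]
    by (simp add: inner_diff_left algebra_simps)
  then have "t * (s * (c * (norm d)\<^sup>2)) \<le> t * ((v - w) \<bullet> d)"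
    by (simp add: k_def t_def mult.commute mult.left_commute)
  then show "s * (c * (norm (x - y))\<^sup>2) \<le> (v - w) \<bullet> (x - y)"
    using t by (simp add: d_def)
qed

lemma minimizer_distance_le:
  assumes sc: "strongly_convex c f" and "c > 0"
    and min: "is_arg_min f (\<lambda>_. True) x" and "f x \<noteq> -\<infinity>"
    and v: "v \<in> subdifferential f y"
  shows "norm (x - y) \<le> norm v / c"
proof (cases "x = y")
  case False
  have "f x \<le> f y" using min by (simp add: is_arg_min_linorder)
  moreover have "\<bar>f y\<bar> \<noteq> \<infinity>" using v by (simp add: subdifferential_def)
  ultimately have "\<bar>f x\<bar> \<noteq> \<infinity>" using \<open>f x \<noteq> -\<infinity>\<close> by auto
  then have "0 \<in> subdifferential f x" by (rule minimizer_zero_subgradient[OF min])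
  from subdifferential_strongly_monotone[OF sc v this]
  have "c * (norm (y - x))\<^sup>2 \<le> v \<bullet> (y - x)" by simp
  also have "\<dots> \<le> norm v * norm (y - x)" by (rule norm_cauchy_schwarz)
  finally have "(c * norm (y - x)) * norm (y - x) \<le> norm v * norm (y - x)"
    by (simp add: power2_eq_square)
  then have "c * norm (y - x) \<le> norm v" using False by simp
  then show ?thesis using \<open>c > 0\<close>
    by (simp add: field_simps norm_minus_commute)
qed (use \<open>c > 0\<close> in simp)

section \<open>The conjugate of a smooth function\<close>

text \<open>The difference between \<open>g\<close> along the segment and the claimed quadratic bound is nonincreasing,
  since its derivative is controlled by the Lipschitz condition. Applying the mean value theorem
  to \<open>g\<close> itself would give \<open>L\<close> in place of \<open>L / 2\<close>.\<close>

lemma descent_inequality: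
  fixes g :: "'a::real_inner \<Rightarrow> real"
  assumes grad: "\<And>x. GDERIV g x :> grad_g x" and lip: "L-lipschitz_on UNIV grad_g"
  shows "g (x + d) \<le> g x + grad_g x \<bullet> d + L / 2 * (norm d)\<^sup>2"
proof -
  define k where "k t = g (x + t *\<^sub>R d) - t * (grad_g x \<bullet> d) - L / 2 * t\<^sup>2 * (norm d)\<^sup>2" for t
  have "k 1 \<le> k 0"
  proof (rule DERIV_nonpos_imp_nonincreasing[of 0 1])
    fix t :: real
    assume t: "0 \<le> t" "t \<le> 1"
    have "((\<lambda>t. g (x + t *\<^sub>R d)) has_derivative (\<lambda>h. (h *\<^sub>R d) \<bullet> grad_g (x + t *\<^sub>R d))) (at t)"
      using grad[of "x + t *\<^sub>R d"] unfolding gderiv_def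
      by (rule has_derivative_compose[rotated]) (auto intro!: derivative_eq_intros)
    then have "((\<lambda>t. g (x + t *\<^sub>R d)) has_real_derivative grad_g (x + t *\<^sub>R d) \<bullet> d) (at t)"
      by (rule has_derivative_imp_has_field_derivative) (simp add: inner_commute)
    then have D: "(k has_real_derivative
        grad_g (x + t *\<^sub>R d) \<bullet> d - grad_g x \<bullet> d - L * t * (norm d)\<^sup>2) (at t)"
      unfolding k_def[abs_def] by (auto intro!: derivative_eq_intros)
    have "(grad_g (x + t *\<^sub>R d) - grad_g x) \<bullet> d \<le> norm (grad_g (x + t *\<^sub>R d) - grad_g x) * norm d"
      by (rule norm_cauchy_schwarz)
    also have "norm (grad_g (x + t *\<^sub>R d) - grad_g x) \<le> L * (t * norm d)"
      using lipschitz_onD[OF lip, of "x + t *\<^sub>R d" x] t by (simp add: dist_norm)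
    then have "norm (grad_g (x + t *\<^sub>R d) - grad_g x) * norm d \<le> L * (t * norm d) * norm d"
      by (rule mult_right_mono) simp
    finally have "grad_g (x + t *\<^sub>R d) \<bullet> d - grad_g x \<bullet> d - L * t * (norm d)\<^sup>2 \<le> 0"
      by (simp add: inner_diff_left power2_eq_square)
    with D show "\<exists>y. (k has_real_derivative y) (at t) \<and> y \<le> 0" by blast
  qed simp
  then show ?thesis by (simp add: k_def)
qed

lemma fenchel_young: "ereal (y \<bullet> x - g x) \<le> fenchel_conjugate g y"
  unfolding fenchel_conjugate_def by (rule SUP_upper) simp

lemma fenchel_conjugate_not_MInfty: "fenchel_conjugate g y \<noteq> -\<infinity>"
  using fenchel_young[of y 0 g] by auto

text \<open>To bound the conjugate at \<open>(1 - t) y + t z\<close>, fix a competitor \<open>x\<close> in its supremum and use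
  \<open>x + a\<close> at \<open>y\<close> and \<open>x + b\<close> at \<open>z\<close>, where \<open>(1 - t) a + t b = 0\<close>. The gradient terms of the two
  descent inequalities then cancel. The gain from the inner products is linear in the shift and
  the loss from the descent inequalities quadratic; the shifts are scaled so as to maximize gain
  minus loss, leaving exactly \<open>\<beta> / 2 * t * (1 - t) * (norm (y - z))\<^sup>2\<close>.\<close>

lemma strongly_convex_fenchel_conjugate:
  fixes g :: "'a::real_inner \<Rightarrow> real"
  assumes grad: "\<And>x. GDERIV g x :> grad_g x" and lip: "(1 / \<beta>)-lipschitz_on UNIV grad_g"
    and "\<beta> > 0"
  shows "strongly_convex \<beta> (fenchel_conjugate g)"
  unfolding strongly_convex_def
proof (intro allI impI)
  fix y z p q and t :: real
  assume p: "fenchel_conjugate g y = ereal p" and q: "fenchel_conjugate g z = ereal q"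
    and t: "0 < t" "t < 1"
  define d where "d = y - z"
  let ?m = "(1 - t) *\<^sub>R y + t *\<^sub>R z"
  have "?m \<bullet> x - g x \<le> (1 - t) * p + t * q - \<beta> / 2 * (t * (1 - t)) * (norm d)\<^sup>2" for x
  proof -
    define a where "a = (\<beta> * t) *\<^sub>R d"
    define b where "b = - ((\<beta> * (1 - t)) *\<^sub>R d)"
    have "y \<bullet> (x + a) - g (x + a) \<le> p" "z \<bullet> (x + b) - g (x + b) \<le> q"
      using fenchel_young[of y "x + a" g] fenchel_young[of z "x + b" g] by (simp_all add: p q)
    moreover have "g (x + a) \<le> g x + grad_g x \<bullet> a + (1 / \<beta>) / 2 * (norm a)\<^sup>2"
      "g (x + b) \<le> g x + grad_g x \<bullet> b + (1 / \<beta>) / 2 * (norm b)\<^sup>2"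
      by (rule descent_inequality[OF grad lip])+
    ultimately have "y \<bullet> (x + a) - (g x + grad_g x \<bullet> a + (1 / \<beta>) / 2 * (norm a)\<^sup>2) \<le> p"
      "z \<bullet> (x + b) - (g x + grad_g x \<bullet> b + (1 / \<beta>) / 2 * (norm b)\<^sup>2) \<le> q"
      by linarith+
    then have "(1 - t) * (y \<bullet> (x + a) - (g x + grad_g x \<bullet> a + (1 / \<beta>) / 2 * (norm a)\<^sup>2))
        + t * (z \<bullet> (x + b) - (g x + grad_g x \<bullet> b + (1 / \<beta>) / 2 * (norm b)\<^sup>2))
        \<le> (1 - t) * p + t * q"
      using t by (intro add_mono mult_left_mono) auto
    moreover have "(1 - t) * (y \<bullet> (x + a) - (g x + grad_g x \<bullet> a + (1 / \<beta>) / 2 * (norm a)\<^sup>2))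
        + t * (z \<bullet> (x + b) - (g x + grad_g x \<bullet> b + (1 / \<beta>) / 2 * (norm b)\<^sup>2))
        = ?m \<bullet> x - g x + \<beta> / 2 * (t * (1 - t)) * (norm d)\<^sup>2"
    proof -
      have na: "(1 / \<beta>) / 2 * (norm a)\<^sup>2 = \<beta> / 2 * t\<^sup>2 * (norm d)\<^sup>2"
        and nb: "(1 / \<beta>) / 2 * (norm b)\<^sup>2 = \<beta> / 2 * (1 - t)\<^sup>2 * (norm d)\<^sup>2"
        using \<open>\<beta> > 0\<close> by (simp_all add: a_def b_def power_mult_distrib)
          (simp_all add: power2_eq_square)
      have ip: "(norm d)\<^sup>2 = y \<bullet> d - z \<bullet> d"
        by (simp add: d_def power2_norm_eq_inner inner_diff_left)
      show ?thesis
        unfolding na nb unfolding ip unfolding a_def b_def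
        by (simp add: inner_add_left inner_add_right algebra_simps power2_eq_square)
          (simp add: field_simps)
    qed
    ultimately show ?thesis by linarith
  qed
  then show "fenchel_conjugate g ?m
      \<le> ereal ((1 - t) * p + t * q - \<beta> / 2 * (t * (1 - t)) * (norm (y - z))\<^sup>2)"
    unfolding fenchel_conjugate_def[of g ?m] by (intro SUP_least) (simp add: d_def)
qed

section \<open>Support and log-moment generating function\<close>

text \<open>The complement of the support is a union of open sets of measure zero; by the Lindelof property
  countably many of them suffice.\<close>

lemma borel_probs_AE_supp:
  fixes \<mu> :: "'a::second_countable_topology measure"
  assumes "\<mu> \<in> borel_probs X"
  shows "AE u in \<mu>. u \<in> measure_supp \<mu>"
proof -
  from assms have sets: "sets \<mu> = sets (restrict_space borel X)"
    by (simp add: borel_probs_def)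
  have meas: "U \<inter> space \<mu> \<in> sets \<mu>" if "open U" for U
  proof -
    have "space \<mu> = X"
      using sets_eq_imp_space_eq[OF sets] by (simp add: space_restrict_space)
    moreover have "X \<inter> U \<in> sets (restrict_space borel X)"
      using that unfolding sets_restrict_space by (intro imageI borel_open)
    ultimately show ?thesis by (simp add: sets Int_commute)
  qed
  define \<U> where "\<U> = {U. open U \<and> emeasure \<mu> (U \<inter> space \<mu>) = 0}"
  obtain \<V> where \<V>: "\<V> \<subseteq> \<U>" "countable \<V>" "\<Union>\<V> = \<Union>\<U>"
    using Lindelof[of \<U>] by (auto simp: \<U>_def)
  have "AE u in \<mu>. \<forall>U\<in>\<V>. u \<notin> U"
    unfolding AE_ball_countable[OF \<V>(2)]
  proof
    fix U assume "U \<in> \<V>"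
    then have "U \<inter> space \<mu> \<in> null_sets \<mu>"
      using \<V>(1) meas by (auto simp: \<U>_def null_sets_def)
    then show "AE u in \<mu>. u \<notin> U"
      by (rule AE_I') auto
  qed
  with AE_space show ?thesis
  proof eventually_elim
    case (elim u)
    then have "u \<notin> \<Union>\<U>" using \<V>(3) by blast
    with elim show ?case
      by (auto simp: measure_supp_def \<U>_def zero_less_iff_neq_zero)
  qed
qed

text \<open>The support has full measure, so it is nonempty and the supremum of norms over it is not
  \<open>-\<infinity>\<close>; boundedness of \<open>X\<close> makes it finite.\<close>

lemma sup_norm_measure_supp:
  fixes \<mu> :: "'a::euclidean_space measure"
  assumes \<mu>: "\<mu> \<in> borel_probs X" and "compact X"
  obtains R where "sup_norm (measure_supp \<mu>) = ereal R" "0 \<le> R" "AE u in \<mu>. norm u \<le> R"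
proof -
  interpret prob_space \<mu> using \<mu> by (simp add: borel_probs_def)
  have space: "space \<mu> = X"
    using \<mu> sets_eq_imp_space_eq[of \<mu> "restrict_space borel X"]
    by (auto simp: borel_probs_def space_restrict_space)
  \<comment> \<open>A null event cannot be almost sure under a probability measure.\<close>
  have "measure_supp \<mu> \<noteq> {}"
    using borel_probs_AE_supp[OF \<mu>] by (auto simp: AE_const)
  then obtain u where u: "u \<in> measure_supp \<mu>" by blast
  obtain B where B: "\<And>x. x \<in> X \<Longrightarrow> norm x \<le> B"
    using compact_imp_bounded[OF \<open>compact X\<close>] by (auto simp: bounded_iff)
  have "sup_norm (measure_supp \<mu>) \<le> ereal B"
    unfolding sup_norm_def by (rule SUP_least) (auto simp: measure_supp_def space B)
  moreover have ge: "ereal (norm x) \<le> sup_norm (measure_supp \<mu>)" if "x \<in> measure_supp \<mu>" for x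
    unfolding sup_norm_def using that by (rule SUP_upper)
  ultimately obtain R where R: "sup_norm (measure_supp \<mu>) = ereal R"
    using ge[OF u] by (cases "sup_norm (measure_supp \<mu>)") auto
  show ?thesis
  proof
    show "sup_norm (measure_supp \<mu>) = ereal R" by (fact R)
    show "0 \<le> R" using ge[OF u] norm_ge_zero[of u] unfolding R ereal_less_eq by linarith
    show "AE u in \<mu>. norm u \<le> R"
      using borel_probs_AE_supp[OF \<mu>] by eventually_elim (use ge R in force)
  qed
qed

lemma borel_probs_integrable_continuous:
  fixes f :: "'a::euclidean_space \<Rightarrow> 'b::euclidean_space"
  assumes \<mu>: "\<mu> \<in> borel_probs X" and "compact X" and f: "continuous_on X f"
  shows "integrable \<mu> f"
proof -
  interpret prob_space \<mu> using \<mu> by (simp add: borel_probs_def)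
  have sets: "sets \<mu> = sets (restrict_space borel X)" using \<mu> by (simp add: borel_probs_def)
  have space: "space \<mu> = X"
    using sets_eq_imp_space_eq[OF sets] by (simp add: space_restrict_space)
  have "f \<in> borel_measurable \<mu>"
    unfolding measurable_cong_sets[OF sets refl] by (rule borel_measurable_continuous_on_restrict[OF f])
  moreover obtain B where "\<And>x. x \<in> X \<Longrightarrow> norm (f x) \<le> B"
    using compact_imp_bounded[OF compact_continuous_image[OF f \<open>compact X\<close>]]
    by (auto simp: bounded_iff)
  ultimately show ?thesis
    by (intro integrable_const_bound[of _ B]) (auto simp: space intro!: AE_I2)
qed

text \<open>The subgradient \<open>w\<close> is the mean of the probability measure with density proportional to
  \<open>exp (y \<bullet> u)\<close>. Writing \<open>d = y' - y\<close>, the subgradient inequality is Jensen's inequality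
  \<open>exp (w \<bullet> d) \<le> E[exp (u \<bullet> d)]\<close> for this tilted measure; it follows by integrating the tangent
  bound \<open>exp s \<ge> exp c * (1 + s - c)\<close> at \<open>s = u \<bullet> d\<close> and \<open>c = w \<bullet> d\<close>.\<close>

lemma log_mgf_subgradient:
  fixes \<mu> :: "'a::euclidean_space measure"
  assumes \<mu>: "\<mu> \<in> borel_probs X" and X: "compact X" and R: "AE u in \<mu>. norm u \<le> R"
  obtains w where "norm w \<le> R" "\<And>y'. log_mgf \<mu> y + w \<bullet> (y' - y) \<le> log_mgf \<mu> y'"
proof -
  interpret prob_space \<mu> using \<mu> by (simp add: borel_probs_def)
  note int = borel_probs_integrable_continuous[OF \<mu> X]
  define M where "M y = (\<integral>u. exp (y \<bullet> u) \<partial>\<mu>)" for y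
  define v where "v = (\<integral>u. exp (y \<bullet> u) *\<^sub>R u \<partial>\<mu>)"
  define w where "w = v /\<^sub>R M y"
  have int_exp: "integrable \<mu> (\<lambda>u. exp (y \<bullet> u))" for y
    by (intro int continuous_intros)
  have int_v: "integrable \<mu> (\<lambda>u. exp (y \<bullet> u) *\<^sub>R u)"
    by (intro int continuous_intros)
  have M_pos: "M y > 0" for y
  proof -
    have "M y \<ge> 0" unfolding M_def by simp
    moreover have "M y \<noteq> 0"
      unfolding M_def by (subst integral_nonneg_eq_0_iff_AE[OF int_exp]) auto
    ultimately show ?thesis by simp
  qed
  have "norm v \<le> (\<integral>u. norm (exp (y \<bullet> u) *\<^sub>R u) \<partial>\<mu>)"
    unfolding v_def by (rule integral_norm_bound)
  also have "\<dots> \<le> (\<integral>u. R * exp (y \<bullet> u) \<partial>\<mu>)"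
  proof (rule integral_mono_AE)
    show "AE u in \<mu>. norm (exp (y \<bullet> u) *\<^sub>R u) \<le> R * exp (y \<bullet> u)"
      using R by eventually_elim (simp add: mult.commute)
  qed (use int_exp integrable_norm[OF int_v] in simp_all)
  also have "\<dots> = R * M y" by (simp add: M_def)
  finally have "norm w \<le> R" using M_pos[of y] by (simp add: w_def field_simps)
  moreover have "log_mgf \<mu> y + w \<bullet> (y' - y) \<le> log_mgf \<mu> y'" for y'
  proof -
    define d where "d = y' - y"
    define c where "c = w \<bullet> d"
    have int_d: "integrable \<mu> (\<lambda>u. exp (y \<bullet> u) * (u \<bullet> d))"
      by (intro int continuous_intros)
    have vd: "(\<integral>u. exp (y \<bullet> u) * (u \<bullet> d) \<partial>\<mu>) = M y * c"
    proof -
      have "(\<integral>u. exp (y \<bullet> u) * (u \<bullet> d) \<partial>\<mu>) = v \<bullet> d"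
        unfolding v_def using integral_inner_left[of d \<mu> "\<lambda>u. exp (y \<bullet> u) *\<^sub>R u"] int_v by simp
      then show ?thesis using M_pos[of y] by (simp add: c_def w_def)
    qed
    have "exp c * M y = exp c * ((1 - c) * M y + M y * c)" by (simp add: algebra_simps)
    also have "\<dots> = (\<integral>u. exp c * ((1 - c) * exp (y \<bullet> u) + exp (y \<bullet> u) * (u \<bullet> d)) \<partial>\<mu>)"
      using int_exp int_d by (simp add: vd M_def)
    also have "\<dots> \<le> (\<integral>u. exp (y' \<bullet> u) \<partial>\<mu>)"
    proof (rule integral_mono)
      fix u
      have "1 + (u \<bullet> d - c) \<le> exp (u \<bullet> d - c)" by (rule exp_ge_add_one_self)
      then have "exp c * exp (y \<bullet> u) * (1 + (u \<bullet> d - c))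
          \<le> exp c * exp (y \<bullet> u) * exp (u \<bullet> d - c)"
        by (intro mult_left_mono) auto
      also have "\<dots> = exp (y' \<bullet> u)"
        by (simp add: d_def inner_diff_right inner_commute flip: exp_add)
      finally show "exp c * ((1 - c) * exp (y \<bullet> u) + exp (y \<bullet> u) * (u \<bullet> d)) \<le> exp (y' \<bullet> u)"
        by (simp add: algebra_simps)
    qed (use int_exp int_d in auto)
    finally have "exp c * M y \<le> M y'" by (simp add: M_def)
    then have "ln (exp c * M y) \<le> ln (M y')"
      using M_pos by simp
    then show ?thesis
      using M_pos[of y] by (simp add: ln_mult log_mgf_def c_def d_def flip: M_def)
  qed
  ultimately show ?thesis by (rule that)
qed

text \<open>A function with a subgradient at every point is convex: average the subgradient inequality at
  \<open>(1 - t) x + t y\<close> over the two end points.\<close>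

lemma log_mgf_convex:
  fixes \<mu> :: "'a::euclidean_space measure"
  assumes \<mu>: "\<mu> \<in> borel_probs X" and X: "compact X" and t: "0 \<le> t" "t \<le> 1"
  shows "log_mgf \<mu> ((1 - t) *\<^sub>R x + t *\<^sub>R y) \<le> (1 - t) * log_mgf \<mu> x + t * log_mgf \<mu> y"
proof -
  let ?m = "(1 - t) *\<^sub>R x + t *\<^sub>R y"
  obtain R where R: "AE u in \<mu>. norm u \<le> R" using sup_norm_measure_supp[OF \<mu> X] by blast
  obtain w where w: "\<And>y'. log_mgf \<mu> ?m + w \<bullet> (y' - ?m) \<le> log_mgf \<mu> y'"
    using log_mgf_subgradient[OF \<mu> X R, of ?m] by blast
  have "(1 - t) * (log_mgf \<mu> ?m + w \<bullet> (x - ?m)) + t * (log_mgf \<mu> ?m + w \<bullet> (y - ?m))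
      \<le> (1 - t) * log_mgf \<mu> x + t * log_mgf \<mu> y"
    using t w by (intro add_mono mult_left_mono) auto
  then show ?thesis by (simp add: inner_diff_right inner_add_right algebra_simps)
qed

section \<open>The dual objective\<close>

lemma dual_mem_not_MInfty: "\<alpha> > 0 \<Longrightarrow> dual_mem g A b \<alpha> \<mu> z \<noteq> -\<infinity>"
  using fenchel_conjugate_not_MInfty[of g "- z /\<^sub>R \<alpha>"]
  by (cases "fenchel_conjugate g (- z /\<^sub>R \<alpha>)") (simp_all add: dual_mem_def)

lemma dual_mem_finiteE:
  assumes "dual_mem g A b \<alpha> \<mu> z = ereal p" "\<alpha> > 0"
  obtains p' where "fenchel_conjugate g (- z /\<^sub>R \<alpha>) = ereal p'"
    "p = \<alpha> * p' - b \<bullet> z + log_mgf \<mu> (transpose A *v z)"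
  using assms fenchel_conjugate_not_MInfty[of g "- z /\<^sub>R \<alpha>"]
  by (cases "fenchel_conjugate g (- z /\<^sub>R \<alpha>)") (simp_all add: dual_mem_def)

text \<open>Rescaling the argument by \<open>1 / \<alpha>\<close> divides the modulus \<open>\<beta>\<close> by \<open>\<alpha>\<^sup>2\<close>, and the outer factor \<open>\<alpha>\<close>
  brings it back to \<open>\<beta> / \<alpha>\<close>; the affine and the convex term leave the modulus unchanged.\<close>

lemma strongly_convex_dual_mem:
  fixes A :: "real^'m^'d"
  assumes sc: "strongly_convex \<beta> (fenchel_conjugate g)" and \<alpha>: "\<alpha> > 0"
    and \<mu>: "\<mu> \<in> borel_probs X" and X: "compact X"
  shows "strongly_convex (\<beta> / \<alpha>) (dual_mem g A b \<alpha> \<mu>)"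
  unfolding strongly_convex_def
proof (intro allI impI)
  fix x y p q and t :: real
  assume "dual_mem g A b \<alpha> \<mu> x = ereal p" and "dual_mem g A b \<alpha> \<mu> y = ereal q"
    and t: "0 < t" "t < 1"
  then obtain p' q' where p': "fenchel_conjugate g (- x /\<^sub>R \<alpha>) = ereal p'"
      "p = \<alpha> * p' - b \<bullet> x + log_mgf \<mu> (transpose A *v x)"
    and q': "fenchel_conjugate g (- y /\<^sub>R \<alpha>) = ereal q'"
      "q = \<alpha> * q' - b \<bullet> y + log_mgf \<mu> (transpose A *v y)"
    by (elim dual_mem_finiteE[OF _ \<alpha>]) blast
  let ?m = "(1 - t) *\<^sub>R x + t *\<^sub>R y"
  let ?L = "\<lambda>z. log_mgf \<mu> (transpose A *v z)"
  have m: "(1 - t) *\<^sub>R (- x /\<^sub>R \<alpha>) + t *\<^sub>R (- y /\<^sub>R \<alpha>) = - ?m /\<^sub>R \<alpha>"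
    by (simp add: algebra_simps)
  have d: "(norm (- x /\<^sub>R \<alpha> - - y /\<^sub>R \<alpha>))\<^sup>2 = (norm (x - y))\<^sup>2 / \<alpha>\<^sup>2"
  proof -
    have "- x /\<^sub>R \<alpha> - - y /\<^sub>R \<alpha> = - ((x - y) /\<^sub>R \<alpha>)" by (simp add: algebra_simps)
    then show ?thesis using \<alpha> by (simp only: norm_minus_cancel) (simp add: divide_inverse power_mult_distrib power_inverse)
  qed
  define r where "r = (1 - t) * p' + t * q' - \<beta> / 2 * (t * (1 - t)) * ((norm (x - y))\<^sup>2 / \<alpha>\<^sup>2)"
  have r: "fenchel_conjugate g (- ?m /\<^sub>R \<alpha>) \<le> ereal r"
    using strongly_convexD[OF sc p'(1) q'(1) t] unfolding m d r_def .
  have L: "?L ?m \<le> (1 - t) * ?L x + t * ?L y"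
    using log_mgf_convex[OF \<mu> X, of t "transpose A *v x" "transpose A *v y"] t
    by (simp add: matrix_vector_right_distrib matrix_vector_mult_scaleR)
  have "dual_mem g A b \<alpha> \<mu> ?m
      \<le> ereal \<alpha> * ereal r - ereal (b \<bullet> ?m) + ereal ((1 - t) * ?L x + t * ?L y)"
    unfolding dual_mem_def using r L \<alpha>
    by (intro add_mono ereal_minus_mono ereal_mult_left_mono) auto
  also have "\<dots> = ereal ((1 - t) * p + t * q - (\<beta> / \<alpha>) / 2 * (t * (1 - t)) * (norm (x - y))\<^sup>2)"
  proof -
    have "\<alpha> * (\<beta> / 2 * (t * (1 - t)) * ((norm (x - y))\<^sup>2 / \<alpha>\<^sup>2))
        = (\<beta> / \<alpha>) / 2 * (t * (1 - t)) * (norm (x - y))\<^sup>2"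
      using \<alpha> by (simp add: power2_eq_square)
    then show ?thesis
      unfolding r_def p' q' by (simp add: right_diff_distrib) (simp add: inner_add_right algebra_simps)
  qed
  finally show "dual_mem g A b \<alpha> \<mu> ?m
      \<le> ereal ((1 - t) * p + t * q - (\<beta> / \<alpha>) / 2 * (t * (1 - t)) * (norm (x - y))\<^sup>2)" .
qed

text \<open>The chain and sum rules, in the elementary direction that only adds up subgradient
  inequalities. The inner derivative \<open>- 1 / \<alpha>\<close> cancels the factor \<open>\<alpha>\<close>, so the conjugate contributes
  \<open>- v\<close> with no scaling.\<close>

lemma dual_mem_subgradient:
  fixes A :: "real^'m^'d"
  assumes v: "v \<in> subdifferential (fenchel_conjugate g) (- z /\<^sub>R \<alpha>)" and \<alpha>: "\<alpha> > 0"
    and \<mu>: "\<mu> \<in> borel_probs X" and X: "compact X" and R: "AE u in \<mu>. norm u \<le> R"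
  obtains s where "s \<in> subdifferential (dual_mem g A b \<alpha> \<mu>) z"
    "norm s \<le> norm v + norm b + onorm ((*v) A) * R"
proof -
  obtain w where nw: "norm w \<le> R"
    and w: "\<And>y'. log_mgf \<mu> (transpose A *v z) + w \<bullet> (y' - transpose A *v z) \<le> log_mgf \<mu> y'"
    using log_mgf_subgradient[OF \<mu> X R, of "transpose A *v z"] by blast
  define s where "s = A *v w - v - b"
  obtain p where p: "fenchel_conjugate g (- z /\<^sub>R \<alpha>) = ereal p"
    using v by (auto simp: subdifferential_def)
  have "dual_mem g A b \<alpha> \<mu> z + ereal (s \<bullet> (y - z)) \<le> dual_mem g A b \<alpha> \<mu> y" for y
  proof (cases "dual_mem g A b \<alpha> \<mu> y")
    case (real q)
    from dual_mem_finiteE[OF this \<alpha>] obtain q' where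
      q': "fenchel_conjugate g (- y /\<^sub>R \<alpha>) = ereal q'"
      "q = \<alpha> * q' - b \<bullet> y + log_mgf \<mu> (transpose A *v y)" .
    have "p + v \<bullet> (- y /\<^sub>R \<alpha> - - z /\<^sub>R \<alpha>) \<le> q'"
    proof -
      have "fenchel_conjugate g (- z /\<^sub>R \<alpha>) + ereal (v \<bullet> (- y /\<^sub>R \<alpha> - - z /\<^sub>R \<alpha>))
          \<le> fenchel_conjugate g (- y /\<^sub>R \<alpha>)"
        using v unfolding subdifferential_def by blast
      then show ?thesis unfolding p q'(1) by simp
    qed
    then have "\<alpha> * (p + v \<bullet> (- y /\<^sub>R \<alpha> - - z /\<^sub>R \<alpha>)) \<le> \<alpha> * q'"
      using \<alpha> by simp
    moreover have "\<alpha> * (p + v \<bullet> (- y /\<^sub>R \<alpha> - - z /\<^sub>R \<alpha>)) = \<alpha> * p - v \<bullet> (y - z)"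
      using \<alpha> by (simp add: inner_diff_right field_simps)
    moreover have "(A *v w) \<bullet> (y - z) = w \<bullet> (transpose A *v y - transpose A *v z)"
      by (metis dot_lmul_matrix inner_commute matrix_vector_mult_diff_distrib transpose_matrix_vector)
    ultimately have "\<alpha> * p - b \<bullet> z + log_mgf \<mu> (transpose A *v z) + s \<bullet> (y - z) \<le> q"
      using w[of "transpose A *v y"] unfolding q'(2)
      by (simp add: s_def inner_diff_left inner_diff_right)
    then show ?thesis unfolding real dual_mem_def[of g A b \<alpha> \<mu> z] p by simp
  qed (use dual_mem_not_MInfty[OF \<alpha>, of g A b \<mu> y] in auto)
  then have "s \<in> subdifferential (dual_mem g A b \<alpha> \<mu>) z"
    unfolding subdifferential_def dual_mem_def[of g A b \<alpha> \<mu> z] p by simp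
  moreover have "norm s \<le> norm v + norm b + onorm ((*v) A) * R"
  proof -
    have bl: "bounded_linear ((*v) A)" by (rule matrix_vector_mul_bounded_linear)
    have "norm (A *v w) \<le> onorm ((*v) A) * norm w" by (rule onorm[OF bl])
    also have "\<dots> \<le> onorm ((*v) A) * R"
      using nw onorm_pos_le[OF bl] by (rule mult_left_mono)
    finally show ?thesis
      unfolding s_def using norm_triangle_ineq4[of "A *v w - v" b] norm_triangle_ineq4[of "A *v w" v]
      by linarith
  qed
  ultimately show ?thesis by (rule that)
qed

theorem theorem3p5:
  fixes X :: "(real^'m) set" and A :: "real^'m^'d" and b :: "real^'d"
    and \<alpha> \<beta> :: real and g :: "real^'d \<Rightarrow> real" and grad_g :: "real^'d \<Rightarrow> real^'d"
    and \<rho> \<eta> :: "(real^'m) measure" and z_\<rho> z_\<eta> :: "real^'d"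
  assumes "compact X"
    and "\<alpha> > 0" and "\<beta> > 0"
    and "convex_on UNIV g"
    and "\<And>x. GDERIV g x :> grad_g x"
    and "(1 / \<beta>)-lipschitz_on UNIV grad_g"
    and "\<rho> \<in> borel_probs X" and "\<eta> \<in> borel_probs X"
    and "dual_mem_solution g A b \<alpha> \<rho> z_\<rho>"
    and "dual_mem_solution g A b \<alpha> \<eta> z_\<eta>"
  shows "ereal (norm (z_\<rho> - z_\<eta>))
           \<le> ereal (\<alpha> / \<beta>) * min_norm (subdifferential (dual_mem g A b \<alpha> \<eta>) z_\<rho>
                                     \<union> subdifferential (dual_mem g A b \<alpha> \<rho>) z_\<eta>)
       \<and> (\<forall>z. ereal (norm (z_\<eta> - z))
               \<le> ereal (\<alpha> / \<beta>) * (min_norm (subdifferential (fenchel_conjugate g) (- z /\<^sub>R \<alpha>))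
                    + ereal (norm b) + ereal (onorm ((*v) A)) * sup_norm (measure_supp \<eta>))
            \<and> ereal (norm z_\<eta>)
               \<le> ereal (\<alpha> / \<beta>) * (min_norm (subdifferential (fenchel_conjugate g) (- z /\<^sub>R \<alpha>))
                    + ereal (norm b) + ereal (onorm ((*v) A)) * sup_norm (measure_supp \<eta>))
                 + ereal (norm z))"
proof -
  note X = assms(1) and \<alpha> = assms(2) and \<beta> = assms(3) and \<rho> = assms(7) and \<eta> = assms(8)
  have sc: "strongly_convex (\<beta> / \<alpha>) (dual_mem g A b \<alpha> \<mu>)" if "\<mu> \<in> borel_probs X" for \<mu>
    using strongly_convex_dual_mem[OF strongly_convex_fenchel_conjugate[OF assms(5,6) \<beta>] \<alpha> that X] .
  have dist: "norm (z\<^sub>\<mu> - z) \<le> \<alpha> / \<beta> * norm v"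
    if "\<mu> \<in> borel_probs X" "dual_mem_solution g A b \<alpha> \<mu> z\<^sub>\<mu>"
      "v \<in> subdifferential (dual_mem g A b \<alpha> \<mu>) z" for \<mu> z\<^sub>\<mu> z v
    using minimizer_distance_le[OF sc[OF that(1)] _ that(2)[unfolded dual_mem_solution_def]
        dual_mem_not_MInfty[OF \<alpha>] that(3)] \<alpha> \<beta> by (simp add: mult.commute)
  have "ereal (norm (z_\<rho> - z_\<eta>))
      \<le> ereal (\<alpha> / \<beta>) * min_norm (subdifferential (dual_mem g A b \<alpha> \<eta>) z_\<rho>
                                     \<union> subdifferential (dual_mem g A b \<alpha> \<rho>) z_\<eta>)"
    (is "_ \<le> _ * min_norm ?G")
  proof (rule min_norm_cases[of ?G])
    show "closed ?G" by (intro closed_Un closed_subdifferential)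
  next
    assume "min_norm ?G = \<infinity>"
    then show ?thesis using \<alpha> \<beta> by simp
  next
    fix v assume v: "v \<in> ?G" "min_norm ?G = ereal (norm v)"
    from v(1) have "norm (z_\<rho> - z_\<eta>) \<le> \<alpha> / \<beta> * norm v"
      using dist[OF \<eta> assms(10)] dist[OF \<rho> assms(9)] by (metis Un_iff norm_minus_commute)
    then show ?thesis by (simp add: v(2))
  qed
  moreover obtain R where R: "sup_norm (measure_supp \<eta>) = ereal R" "0 \<le> R" "AE u in \<eta>. norm u \<le> R"
    using sup_norm_measure_supp[OF \<eta> X] .
  have bound: "ereal (norm (z_\<eta> - z))
      \<le> ereal (\<alpha> / \<beta>) * (min_norm (subdifferential (fenchel_conjugate g) (- z /\<^sub>R \<alpha>))
           + ereal (norm b) + ereal (onorm ((*v) A)) * sup_norm (measure_supp \<eta>))"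
    (is "_ \<le> _ * (min_norm ?S + _ + _)") for z
  proof (rule min_norm_cases[of ?S])
    show "closed ?S" by (rule closed_subdifferential)
  next
    assume "min_norm ?S = \<infinity>"
    then show ?thesis using \<alpha> \<beta> by (simp add: R(1))
  next
    fix v assume v: "v \<in> ?S" "min_norm ?S = ereal (norm v)"
    obtain s where s: "s \<in> subdifferential (dual_mem g A b \<alpha> \<eta>) z"
      "norm s \<le> norm v + norm b + onorm ((*v) A) * R"
      using dual_mem_subgradient[OF v(1) \<alpha> \<eta> X R(3)] .
    have "norm (z_\<eta> - z) \<le> \<alpha> / \<beta> * norm s" by (rule dist[OF \<eta> assms(10) s(1)])
    also have "\<dots> \<le> \<alpha> / \<beta> * (norm v + norm b + onorm ((*v) A) * R)"
      using s(2) \<alpha> \<beta> by (intro mult_left_mono) auto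
    finally show ?thesis unfolding v(2) R(1) by simp
  qed
  moreover have "ereal (norm z_\<eta>) \<le> B + ereal (norm z)" if "ereal (norm (z_\<eta> - z)) \<le> B" for z B
  proof -
    have "ereal (norm z_\<eta>) \<le> ereal (norm (z_\<eta> - z)) + ereal (norm z)"
      using norm_triangle_ineq[of "z_\<eta> - z" z] by simp
    also have "\<dots> \<le> B + ereal (norm z)" using that by (rule add_right_mono)
    finally show ?thesis .
  qed
  ultimately show ?thesis by blast
qed

end
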